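(* Let $\mathbb{A}$ be a unital $C^*$-algebra, let $(X,\mathbb{A},p)$ be a complete $C^*$-algebra valued partial metric space, and let $T:X\to X$ be a mapping for which there are real numbers $\alpha,\beta,\gamma\in[0,\infty)$ with $\alpha+\beta+\gamma<1$ such that $$p(Tx,Ty)\preceq \alpha\,p(x,y)+\beta\,p(x,Tx)+\gamma\,p(y,Ty)\quad\text{for all }x,y\in X.$$ Then $T$ has a unique fixed point $u\in X$, and $p(u,u)=\theta$.
   Context: $\mathbb{A}$ is a unital $C^*$-algebra with unit $I$ and zero element $\theta$; $\mathbb{A}_+$ is the set of positive elements, and for self-adjoint $a,b$, $a\preceq b$ means $b-a\in\mathbb{A}_+$. A $C^*$-algebra valued partial metric space $(X,\mathbb{A},p)$ is a non-empty set $X$ with $p:X\times X\to\mathbb{A}$ such that for all $x,y,z\in X$: (i) $\theta\preceq p(x,y)$, and $p(x,x)=p(y,y)=p(x,y)$ iff $x=y$; (ii) $p(x,y)=p(y,x)$; (iii) $p(x,x)\preceq p(x,y)$; (iv) $p(x,y)\preceq p(x,z)+p(z,y)-p(z,z)$. A sequence $(x_n)$ converges to $x$ if $\lim_n (p(x_n,x)-p(x,x))=\theta$ in norm. It is partial Cauchy if for every $\varepsilon>0$ there is $N$ such that for all $n,m>N$, $q_{n,m}q_{n,m}^*\preceq\varepsilon^2 I$, where $q_{n,m}=p(x_n,x_m)-\frac12p(x_n,x_n)-\frac12p(x_m,x_m)$. The space is complete if every partial Cauchy sequence $(x_n)$ converges to a point $x\in X$ such that $\lim_n\bigl(p(x_n,x)-\frac12p(x_n,x_n)-\frac12p(x,x)\bigr)=\theta$.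 *)

theory Defs
  imports Complex_Main
begin

class unital_cstar_algebra = real_normed_algebra_1 + banach +
  fixes scaleC :: "complex \<Rightarrow> 'a \<Rightarrow> 'a"  (infixr "*\<^sub>C" 75)
    and adj :: "'a \<Rightarrow> 'a"
  assumes scaleC_of_real: "complex_of_real r *\<^sub>C a = r *\<^sub>R a"
    and scaleC_add_right: "c *\<^sub>C (a + b) = c *\<^sub>C a + c *\<^sub>C b"
    and scaleC_add_left: "(c + d) *\<^sub>C a = c *\<^sub>C a + d *\<^sub>C a"
    and scaleC_scaleC: "c *\<^sub>C d *\<^sub>C a = (c * d) *\<^sub>C a"
    and mult_scaleC_left: "(c *\<^sub>C a) * b = c *\<^sub>C (a * b)"
    and mult_scaleC_right: "a * (c *\<^sub>C b) = c *\<^sub>C (a * b)"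
    and norm_scaleC: "norm (c *\<^sub>C a) = cmod c * norm a"
    and adj_adj: "adj (adj a) = a"
    and adj_add: "adj (a + b) = adj a + adj b"
    and adj_scaleC: "adj (c *\<^sub>C a) = cnj c *\<^sub>C adj a"
    and adj_mult: "adj (a * b) = adj b * adj a"
    and cstar_identity: "norm (adj a * a) = (norm a)\<^sup>2"

definition self_adjoint :: "'a::unital_cstar_algebra \<Rightarrow> bool"
  where "self_adjoint a \<longleftrightarrow> adj a = a"

definition cstar_spectrum :: "'a::unital_cstar_algebra \<Rightarrow> complex set"
  where "cstar_spectrum a =
    {c. \<not> (\<exists>b. (c *\<^sub>C 1 - a) * b = 1 \<and> b * (c *\<^sub>C 1 - a) = 1)}"

definition cstar_positive :: "'a::unital_cstar_algebra \<Rightarrow> bool"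
  where "cstar_positive a \<longleftrightarrow>
    self_adjoint a \<and> cstar_spectrum a \<subseteq> complex_of_real ` {0..}"

text \<open>The order lives on the self-adjoint part of the algebra; the relation is false
  outside it.\<close>

definition cstar_le :: "'a::unital_cstar_algebra \<Rightarrow> 'a \<Rightarrow> bool"  (infix "\<preceq>" 50)
  where "a \<preceq> b \<longleftrightarrow> self_adjoint a \<and> self_adjoint b \<and> cstar_positive (b - a)"

locale cstar_partial_metric_space =
  fixes X :: "'x set" and p :: "'x \<Rightarrow> 'x \<Rightarrow> 'a::unital_cstar_algebra"
  assumes nonempty: "X \<noteq> {}"
    and nonneg: "\<lbrakk>x \<in> X; y \<in> X\<rbrakk> \<Longrightarrow> 0 \<preceq> p x y"
    and eq_iff: "\<lbrakk>x \<in> X; y \<in> X\<rbrakk> \<Longrightarrow> (p x x = p y y \<and> p y y = p x y) \<longleftrightarrow> x = y"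
    and commute: "\<lbrakk>x \<in> X; y \<in> X\<rbrakk> \<Longrightarrow> p x y = p y x"
    and self_le: "\<lbrakk>x \<in> X; y \<in> X\<rbrakk> \<Longrightarrow> p x x \<preceq> p x y"
    and triangle: "\<lbrakk>x \<in> X; y \<in> X; z \<in> X\<rbrakk> \<Longrightarrow> p x y \<preceq> p x z + p z y - p z z"
begin

definition converges_to :: "(nat \<Rightarrow> 'x) \<Rightarrow> 'x \<Rightarrow> bool"
  where "converges_to s x \<longleftrightarrow> (\<lambda>n. p (s n) x - p x x) \<longlonglongrightarrow> 0"

definition centred :: "'x \<Rightarrow> 'x \<Rightarrow> 'a"
  where "centred x y = p x y - (1/2) *\<^sub>R p x x - (1/2) *\<^sub>R p y y"

definition partial_Cauchy :: "(nat \<Rightarrow> 'x) \<Rightarrow> bool"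
  where "partial_Cauchy s \<longleftrightarrow>
    (\<forall>\<epsilon>>0. \<exists>N. \<forall>n>N. \<forall>m>N.
      centred (s n) (s m) * adj (centred (s n) (s m)) \<preceq> \<epsilon>\<^sup>2 *\<^sub>R 1)"

end

locale complete_cstar_partial_metric_space = cstar_partial_metric_space +
  assumes complete: "\<lbrakk>\<And>n. s n \<in> X; partial_Cauchy s\<rbrakk> \<Longrightarrow>
    \<exists>x\<in>X. converges_to s x \<and> (\<lambda>n. centred (s n) x) \<longlonglongrightarrow> 0"

end

theory Submission
  imports Defs "HOL-Analysis.Topology_Euclidean_Space"
begin

text \<open>Once \<open>0 \<preceq> a \<preceq> b\<close> is known to imply \<open>\<parallel>a\<parallel> \<le> \<parallel>b\<parallel>\<close> (\<open>norm_mono_positive\<close>), the order can be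
  forgotten: the real function \<open>\<parallel>p x y\<parallel>\<close> satisfies the triangle inequality, dominates the
  self-distances, and inherits the contraction condition with the same constants. Banach's
  argument then applies. The iterates of any point have consecutive distances that shrink by the
  factor \<open>(\<alpha> + \<beta>) / (1 - \<gamma>) < 1\<close>, so they form a partial Cauchy sequence; its self-distances tend
  to \<open>0\<close>, which forces \<open>p u u = 0\<close> at the limit \<open>u\<close>; and the contraction condition between
  \<open>x\<^sub>n\<close> and \<open>u\<close> gives \<open>p u (T u) = 0\<close>.

  The C*-algebra theory behind the monotonicity of the norm rests on one fact: for self-adjoint
  \<open>a \<noteq> 0\<close>, one of \<open>\<plusminus>\<parallel>a\<parallel>\<close> lies in the spectrum (\<open>norm_attained_on_spectrum\<close>). It follows from
  the reality of the spectrum and from Rickart's elementary form of the spectral radius formula,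
  which averages resolvents over the two square roots of a number instead of using
  vector-valued holomorphic functions. Positivity of \<open>a\<close> then becomes the norm condition
  \<open>\<parallel>t - a\<parallel> \<le> t\<close> for \<open>t \<ge> \<parallel>a\<parallel>\<close>, which makes sums of positive elements positive.\<close>

section \<open>Invertibility and the spectrum\<close>

definition invertible_elem :: "'a::unital_cstar_algebra \<Rightarrow> bool"
  where "invertible_elem a \<longleftrightarrow> (\<exists>b. a * b = 1 \<and> b * a = 1)"

lemma mem_spectrum_iff: "c \<in> cstar_spectrum a \<longleftrightarrow> \<not> invertible_elem (c *\<^sub>C 1 - a)"
  by (simp add: cstar_spectrum_def invertible_elem_def)

lemma scaleC_one [simp]: "1 *\<^sub>C a = (a::'a::unital_cstar_algebra)"
  using scaleC_of_real[of 1 a] by simp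

lemma scaleC_zero_left [simp]: "0 *\<^sub>C a = (0::'a::unital_cstar_algebra)"
  using scaleC_of_real[of 0 a] by simp

lemma scaleC_minus_left [simp]: "(- c) *\<^sub>C a = - (c *\<^sub>C (a::'a::unital_cstar_algebra))"
  using scaleC_add_left[of "- c" c a] by (simp add: eq_neg_iff_add_eq_0)

lemma scaleC_diff_left: "(c - d) *\<^sub>C a = c *\<^sub>C a - d *\<^sub>C (a::'a::unital_cstar_algebra)"
  using scaleC_add_left[of c "- d" a] by simp

lemma scaleC_zero_right [simp]: "c *\<^sub>C 0 = (0::'a::unital_cstar_algebra)"
  using scaleC_add_right[of c 0 "0::'a"] by simp

lemma scaleC_minus_right [simp]: "c *\<^sub>C (- a) = - (c *\<^sub>C (a::'a::unital_cstar_algebra))"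
  using scaleC_add_right[of c "- a" a] by (simp add: eq_neg_iff_add_eq_0)

lemma scaleC_diff_right: "c *\<^sub>C (a - b) = c *\<^sub>C a - c *\<^sub>C (b::'a::unital_cstar_algebra)"
  using scaleC_add_right[of c a "- b"] by simp

lemma invertible_elem_scaleC:
  assumes "invertible_elem a" "c \<noteq> 0"
  shows "invertible_elem (c *\<^sub>C a)"
proof -
  obtain b where b: "a * b = 1" "b * a = 1"
    using assms(1) unfolding invertible_elem_def by blast
  have "(c *\<^sub>C a) * ((1/c) *\<^sub>C b) = 1" "((1/c) *\<^sub>C b) * (c *\<^sub>C a) = 1"
    using assms(2) b by (simp_all add: mult_scaleC_left mult_scaleC_right scaleC_scaleC)
  then show ?thesis unfolding invertible_elem_def by blast
qed

lemma invertible_elem_minus: "invertible_elem (- a) \<longleftrightarrow> invertible_elem a"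
proof -
  have "invertible_elem (- b)" if "invertible_elem b" for b :: 'a
    using invertible_elem_scaleC[OF that, of "- 1"] by simp
  from this[of a] this[of "- a"] show ?thesis by auto
qed

lemma spectrum_reflect: "d - c \<in> cstar_spectrum (d *\<^sub>C 1 - a) \<longleftrightarrow> c \<in> cstar_spectrum a"
proof -
  have "(d - c) *\<^sub>C 1 - (d *\<^sub>C 1 - a) = - (c *\<^sub>C 1 - a)"
    by (simp add: scaleC_diff_left)
  then show ?thesis by (metis mem_spectrum_iff invertible_elem_minus)
qed

lemma spectrum_translate: "d + c \<in> cstar_spectrum (d *\<^sub>C 1 + a) \<longleftrightarrow> c \<in> cstar_spectrum a"
proof -
  have "(d + c) *\<^sub>C 1 - (d *\<^sub>C 1 + a) = c *\<^sub>C 1 - a"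
    by (simp add: scaleC_add_left)
  then show ?thesis by (metis mem_spectrum_iff)
qed

text \<open>The inverse is the sum of the Neumann series.\<close>

lemma invertible_one_minus:
  fixes a :: "'a::unital_cstar_algebra"
  assumes "norm a < 1"
  shows "invertible_elem (1 - a)"
proof -
  have "summable (\<lambda>n. norm a ^ n)"
    using assms by (simp add: summable_geometric)
  then have sm: "summable (\<lambda>n. a ^ n)"
    by (rule summable_comparison_test') (rule norm_power_ineq)
  define S where "S = (\<Sum>n. a ^ n)"
  have head: "(\<Sum>n. a ^ Suc n) = S - 1"
    using suminf_split_head[OF sm] by (simp add: S_def)
  have "a * S = S - 1"
    using suminf_mult[OF sm, of a] head by (simp add: S_def)
  moreover have "S * a = S - 1"
    using suminf_mult2[OF sm, of a] head by (simp add: S_def power_commutes)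
  ultimately have "(1 - a) * S = 1" "S * (1 - a) = 1"
    by (simp_all add: algebra_simps)
  then show ?thesis unfolding invertible_elem_def by blast
qed

lemma spectrum_norm_le:
  assumes "c \<in> cstar_spectrum a"
  shows "cmod c \<le> norm a"
proof (rule ccontr)
  assume "\<not> cmod c \<le> norm a"
  then have lt: "norm a < cmod c" by simp
  then have c: "c \<noteq> 0" by auto
  have "norm ((1/c) *\<^sub>C a) < 1"
    using lt c by (simp add: norm_scaleC norm_divide)
  then have "invertible_elem (c *\<^sub>C (1 - (1/c) *\<^sub>C a))"
    using invertible_elem_scaleC invertible_one_minus c by blast
  then show False
    using assms c by (simp add: mem_spectrum_iff scaleC_diff_right scaleC_scaleC)
qed

section \<open>Self-adjoint elements have real spectrum\<close>

lemma adj_zero [simp]: "adj 0 = (0::'a::unital_cstar_algebra)"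
  using adj_add[of 0 "0::'a"] by simp

lemma adj_minus: "adj (- a) = - adj (a::'a::unital_cstar_algebra)"
  using adj_add[of a "- a"] by (simp add: eq_neg_iff_add_eq_0 add.commute)

lemma adj_diff: "adj (a - b) = adj a - adj (b::'a::unital_cstar_algebra)"
  using adj_add[of a "- b"] by (simp add: adj_minus)

lemma adj_one [simp]: "adj 1 = (1::'a::unital_cstar_algebra)"
  using adj_mult[of "adj 1" "1::'a"] by (simp add: adj_adj)

lemma adj_scaleR: "adj (r *\<^sub>R a) = r *\<^sub>R adj (a::'a::unital_cstar_algebra)"
  using adj_scaleC[of "complex_of_real r" a] by (simp add: scaleC_of_real)

lemma self_adjoint_add: "self_adjoint a \<Longrightarrow> self_adjoint b \<Longrightarrow> self_adjoint (a + b)"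
  and self_adjoint_diff: "self_adjoint a \<Longrightarrow> self_adjoint b \<Longrightarrow> self_adjoint (a - b)"
  and self_adjoint_scaleR: "self_adjoint a \<Longrightarrow> self_adjoint (r *\<^sub>R a)"
  and self_adjoint_one: "self_adjoint 1"
  and self_adjoint_square: "self_adjoint a \<Longrightarrow> self_adjoint (a * a)"
  by (simp_all add: self_adjoint_def adj_add adj_diff adj_scaleR adj_mult)

lemma norm_square_self_adjoint: "self_adjoint a \<Longrightarrow> norm (a * a) = (norm a)\<^sup>2"
  using cstar_identity[of a] by (simp add: self_adjoint_def)

text \<open>Arens' trick: translating \<open>a\<close> by \<open>\<i> t\<close> moves a spectral value \<open>c\<close> to \<open>c + \<i> t\<close>, and
  the C*-identity bounds \<open>\<parallel>a + \<i> t\<parallel>\<^sup>2\<close> by \<open>\<parallel>a\<parallel>\<^sup>2 + t\<^sup>2\<close>. So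
  \<open>\<bar>c + \<i> t\<bar>\<^sup>2 \<le> \<parallel>a\<parallel>\<^sup>2 + t\<^sup>2\<close> for all real \<open>t\<close>, in which the term \<open>2 t Im c\<close> is linear in \<open>t\<close>.\<close>

lemma self_adjoint_spectrum_real:
  fixes a :: "'a::unital_cstar_algebra"
  assumes sa: "self_adjoint a" and c: "c \<in> cstar_spectrum a"
  shows "Im c = 0"
proof (rule ccontr)
  assume im: "Im c \<noteq> 0"
  have bound: "(Re c)\<^sup>2 + (Im c)\<^sup>2 + 2 * t * Im c \<le> (norm a)\<^sup>2" for t :: real
  proof -
    define d where "d = \<i> * complex_of_real t"
    define e where "e = d *\<^sub>C 1 + a"
    have "adj e = a - d *\<^sub>C 1"
      using sa by (simp add: e_def adj_add adj_scaleC self_adjoint_def d_def)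
    then have "adj e * e = (a - d *\<^sub>C 1) * (d *\<^sub>C 1 + a)"
      by (simp only: e_def)
    also have "\<dots> = a * a - (d * d) *\<^sub>C 1"
      by (simp add: algebra_simps mult_scaleC_left mult_scaleC_right scaleC_scaleC
          scaleC_diff_right)
    also have "d * d = - complex_of_real (t\<^sup>2)"
      by (simp add: d_def power2_eq_square algebra_simps)
    finally have e: "adj e * e = a * a + t\<^sup>2 *\<^sub>R 1"
      by (simp add: scaleC_of_real del: of_real_power)
    have "cmod (d + c) \<le> norm e"
      using c spectrum_norm_le spectrum_translate unfolding e_def by blast
    then have "(cmod (d + c))\<^sup>2 \<le> norm (adj e * e)"
      by (simp add: cstar_identity power_mono)
    also have "\<dots> \<le> norm (a * a) + norm (t\<^sup>2 *\<^sub>R (1::'a))"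
      unfolding e by (rule norm_triangle_ineq)
    also have "\<dots> = (norm a)\<^sup>2 + t\<^sup>2"
      by (simp add: norm_square_self_adjoint[OF sa])
    finally show ?thesis
      by (simp add: d_def cmod_power2 power2_sum algebra_simps)
  qed
  \<comment> \<open>For this \<open>t\<close> the linear term alone exceeds the bound.\<close>
  define t where "t = ((norm a)\<^sup>2 + 1) / (2 * Im c)"
  have "2 * t * Im c = (norm a)\<^sup>2 + 1"
    using im by (simp add: t_def)
  then show False
    using bound[of t] zero_le_power2[of "Re c"] zero_le_power2[of "Im c"] by linarith
qed

section \<open>The norm of a self-adjoint element is attained on its spectrum\<close>

text \<open>A resolvent \<open>z \<mapsto> (1 - z c)\<^sup>-\<^sup>1\<close> on the closed unit disc that varies by at most \<open>\<epsilon>\<close>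
  between the unit circle and the circle of radius \<open>r\<close>.\<close>

definition radial_bound :: "'a::unital_cstar_algebra \<Rightarrow> real \<Rightarrow> real \<Rightarrow> bool"
  where "radial_bound c r \<epsilon> \<longleftrightarrow>
    (\<exists>R. (\<forall>z. cmod z \<le> 1 \<longrightarrow> (1 - z *\<^sub>C c) * R z = 1 \<and> R z * (1 - z *\<^sub>C c) = 1) \<and>
         (\<forall>z. cmod z = 1 \<longrightarrow> norm (R z - R (of_real r * z)) \<le> \<epsilon>))"

lemma inverse_one_minus_square:
  fixes x y e :: "'a::unital_cstar_algebra"
  assumes "(1 - e) * x = 1" "x * (1 - e) = 1" "(1 + e) * y = 1" "y * (1 + e) = 1"
  shows "(1 - e * e) * ((1/2) *\<^sub>R (x + y)) = 1" "((1/2) *\<^sub>R (x + y)) * (1 - e * e) = 1"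
proof -
  have f: "1 - e * e = (1 - e) * (1 + e)" "1 - e * e = (1 + e) * (1 - e)"
    by (simp_all add: algebra_simps)
  have 1: "(1 - e * e) * x = 1 + e" "(1 - e * e) * y = 1 - e"
    using assms f by (metis mult.assoc mult.right_neutral)+
  have 2: "x * (1 - e * e) = 1 + e" "y * (1 - e * e) = 1 - e"
    using assms f by (metis mult.assoc mult.left_neutral)+
  show "(1 - e * e) * ((1/2) *\<^sub>R (x + y)) = 1" "((1/2) *\<^sub>R (x + y)) * (1 - e * e) = 1"
    by (simp_all add: distrib_left distrib_right 1 2 flip: scaleR_2)
qed

text \<open>The bound survives squaring because the resolvent of \<open>c\<^sup>2\<close> at \<open>y\<^sup>2\<close> is the mean of the
  resolvents of \<open>c\<close> at \<open>y\<close> and \<open>- y\<close>, and \<open>r y\<close> is a square root of \<open>r\<^sup>2 y\<^sup>2\<close>.\<close>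

lemma radial_bound_square:
  fixes c :: "'a::unital_cstar_algebra"
  assumes "radial_bound c r \<epsilon>" and r: "0 \<le> r" "r \<le> 1"
  shows "radial_bound (c * c) (r\<^sup>2) \<epsilon>"
proof -
  obtain R where inv: "\<And>z. cmod z \<le> 1 \<Longrightarrow> (1 - z *\<^sub>C c) * R z = 1 \<and> R z * (1 - z *\<^sub>C c) = 1"
    and bd: "\<And>z. cmod z = 1 \<Longrightarrow> norm (R z - R (of_real r * z)) \<le> \<epsilon>"
    using assms(1) unfolding radial_bound_def by blast
  define Q where "Q z = (1/2) *\<^sub>R (R (csqrt z) + R (- csqrt z))" for z
  have "(1 - z *\<^sub>C (c * c)) * Q z = 1 \<and> Q z * (1 - z *\<^sub>C (c * c)) = 1" if z: "cmod z \<le> 1" for z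
  proof -
    define y where "y = csqrt z"
    have y: "y * y = z" using power2_csqrt[of z] by (simp add: y_def power2_eq_square)
    have ny: "cmod y \<le> 1" using z by (simp add: y_def)
    have zc: "z *\<^sub>C (c * c) = (y *\<^sub>C c) * (y *\<^sub>C c)"
      by (simp add: mult_scaleC_left mult_scaleC_right scaleC_scaleC y)
    show ?thesis
      unfolding zc Q_def y_def[symmetric]
      using inverse_one_minus_square[of "y *\<^sub>C c" "R y" "R (- y)"] inv[of y] inv[of "- y"] ny
      by simp
  qed
  moreover have "norm (Q z - Q (of_real (r\<^sup>2) * z)) \<le> \<epsilon>" if z: "cmod z = 1" for z
  proof -
    define y where "y = csqrt z"
    define w where "w = of_real r * y"
    have ny: "cmod y = 1" using z by (simp add: y_def)
    have "(csqrt (of_real (r\<^sup>2) * z))\<^sup>2 = w\<^sup>2"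
      by (simp add: w_def y_def power_mult_distrib)
    then have "csqrt (of_real (r\<^sup>2) * z) = w \<or> csqrt (of_real (r\<^sup>2) * z) = - w"
      by (simp only: power2_eq_iff)
    then have Qw: "Q (of_real (r\<^sup>2) * z) = (1/2) *\<^sub>R (R w + R (- w))"
      unfolding Q_def by (auto simp: add.commute)
    have "Q z - Q (of_real (r\<^sup>2) * z) = (1/2) *\<^sub>R ((R y - R w) + (R (- y) - R (- w)))"
      unfolding Qw unfolding Q_def y_def by (simp add: algebra_simps)
    then have "norm (Q z - Q (of_real (r\<^sup>2) * z))
        = norm ((R y - R w) + (R (- y) - R (- w))) / 2" by simp
    also have "\<dots> \<le> (norm (R y - R w) + norm (R (- y) - R (- w))) / 2"
      by (simp add: norm_triangle_ineq)
    also have "\<dots> \<le> \<epsilon>"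
      using bd[of y] bd[of "- y"] ny by (simp add: w_def)
    finally show ?thesis .
  qed
  ultimately show ?thesis unfolding radial_bound_def by blast
qed

lemma radial_bound_power:
  assumes "radial_bound c r \<epsilon>" and "0 \<le> r" "r \<le> 1"
  shows "radial_bound (c ^ (2 ^ k)) (r ^ (2 ^ k)) \<epsilon>"
proof (induction k)
  case 0
  then show ?case using assms(1) by simp
next
  case (Suc k)
  have "radial_bound (c ^ (2 ^ k) * c ^ (2 ^ k)) ((r ^ (2 ^ k))\<^sup>2) \<epsilon>"
    using Suc assms by (intro radial_bound_square) (auto intro: power_le_one)
  then show ?case
    by (simp add: power_add[symmetric] mult_2 power2_eq_square)
qed

lemma resolvent_continuous:
  fixes c :: "'a::unital_cstar_algebra"
  assumes inv: "\<And>z. z \<in> S \<Longrightarrow> (1 - z *\<^sub>C c) * R z = 1 \<and> R z * (1 - z *\<^sub>C c) = 1"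
  shows "continuous_on S R"
  unfolding continuous_on_def
proof
  fix z assume z: "z \<in> S"
  define K where "K = norm c * norm (R z)"
  \<comment> \<open>This is the resolvent identity; it turns continuity into a bound on \<open>R w\<close>.\<close>
  have res: "R w - R z = (w - z) *\<^sub>C (R w * c * R z)" if "w \<in> S" for w
  proof -
    have "(w - z) *\<^sub>C (R w * c * R z)
      = R w * ((1 - z *\<^sub>C c) - (1 - w *\<^sub>C c)) * R z"
      by (simp add: scaleC_diff_left mult_scaleC_left mult_scaleC_right algebra_simps)
    also have "\<dots> = R w * ((1 - z *\<^sub>C c) * R z) - (R w * (1 - w *\<^sub>C c)) * R z"
      by (simp only: right_diff_distrib left_diff_distrib mult.assoc)
    also have "\<dots> = R w - R z"
      using inv[OF z] inv[OF that] by simp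
    finally show ?thesis by simp
  qed
  have lip: "norm (R w - R z) \<le> norm (R w) * (cmod (w - z) * K)" if "w \<in> S" for w
  proof -
    have "norm (R w * c * R z) \<le> norm (R w) * norm c * norm (R z)"
      by (meson norm_mult_ineq mult_right_mono norm_ge_zero order_trans)
    then have "cmod (w - z) * norm (R w * c * R z)
        \<le> cmod (w - z) * (norm (R w) * norm c * norm (R z))"
      by (intro mult_left_mono) auto
    then show ?thesis
      by (simp add: res[OF that] norm_scaleC K_def mult_ac)
  qed
  have lim: "((\<lambda>w. cmod (w - z) * K) \<longlongrightarrow> 0) (at z within S)"
    by (auto intro!: tendsto_eq_intros)
  then have "\<forall>\<^sub>F w in at z within S. cmod (w - z) * K < 1/2"
    by (rule order_tendstoD) simp
  moreover have "\<forall>\<^sub>F w in at z within S. w \<in> S"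
    by (simp add: eventually_at_filter)
  ultimately have "\<forall>\<^sub>F w in at z within S. norm (R w - R z) \<le> (2 * norm (R z)) * (cmod (w - z) * K)"
  proof eventually_elim
    \<comment> \<open>Near \<open>z\<close> the Lipschitz bound absorbs half of \<open>\<parallel>R w\<parallel>\<close>, which is thus locally bounded.\<close>
    case (elim w)
    have "norm (R w) \<le> norm (R z) + norm (R w - R z)"
      using norm_triangle_sub by blast
    moreover have "norm (R w) * (cmod (w - z) * K) \<le> norm (R w) * (1/2)"
      using elim by (intro mult_left_mono) auto
    ultimately have "norm (R w) \<le> 2 * norm (R z)"
      using lip[of w] elim by linarith
    then have "norm (R w) * (cmod (w - z) * K) \<le> 2 * norm (R z) * (cmod (w - z) * K)"
      by (intro mult_right_mono) (auto simp: K_def)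
    then show ?case using lip[of w] elim by linarith
  qed
  moreover have "((\<lambda>w. (2 * norm (R z)) * (cmod (w - z) * K)) \<longlongrightarrow> 0) (at z within S)"
    using tendsto_mult_right_zero[OF lim] by blast
  ultimately have "((\<lambda>w. R w - R z) \<longlongrightarrow> 0) (at z within S)"
    by (rule Lim_null_comparison)
  then show "(R \<longlongrightarrow> R z) (at z within S)"
    using LIM_zero_iff by blast
qed

text \<open>Rickart's elementary replacement for the analytic proof of the spectral radius formula.
  By uniform continuity the resolvent of \<open>c\<close> varies little between the unit circle and some
  circle of radius \<open>r < 1\<close>; the same is then true for every \<open>c\<^sup>N\<close>, \<open>N = 2\<^sup>k\<close>, with \<open>r\<^sup>N\<close> for \<open>r\<close>.
  As \<open>r\<^sup>N c\<^sup>N\<close> is small for large \<open>k\<close>, \<open>(1 - r\<^sup>N c\<^sup>N)\<^sup>-\<^sup>1\<close> is near \<open>1\<close>, hence so is \<open>(1 - c\<^sup>N)\<^sup>-\<^sup>1\<close>,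
  hence \<open>c\<^sup>N\<close> is small.\<close>

lemma power_norm_less_one:
  fixes c :: "'a::unital_cstar_algebra"
  assumes nc: "norm c \<le> 1"
    and inv: "\<And>z. cmod z \<le> 1 \<Longrightarrow> invertible_elem (1 - z *\<^sub>C c)"
  shows "\<exists>k. norm (c ^ (2 ^ k)) < 1"
proof -
  obtain R where R: "\<And>z. cmod z \<le> 1 \<Longrightarrow> (1 - z *\<^sub>C c) * R z = 1 \<and> R z * (1 - z *\<^sub>C c) = 1"
    using inv unfolding invertible_elem_def by metis
  have "continuous_on (cball 0 1) R"
    by (rule resolvent_continuous[where c = c]) (use R in simp)
  then have "uniformly_continuous_on (cball 0 1) R"
    by (rule compact_uniformly_continuous) (rule compact_cball)
  then obtain \<delta> where \<delta>: "\<delta> > 0"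
    "\<And>z w. cmod z \<le> 1 \<Longrightarrow> cmod w \<le> 1 \<Longrightarrow> dist w z < \<delta> \<Longrightarrow> dist (R w) (R z) < 1/8"
    unfolding uniformly_continuous_on_def by (metis mem_cball_0 zero_less_divide_1_iff zero_less_numeral)
  \<comment> \<open>The maximum only keeps \<open>r\<close> nonnegative when \<open>\<delta>\<close> is large.\<close>
  define r where "r = max (1/2) (1 - \<delta>/2)"
  have r: "0 \<le> r" "r < 1" "1 - r < \<delta>" using \<delta>(1) by (auto simp: r_def)
  have "norm (R z - R (of_real r * z)) \<le> 1/8" if z: "cmod z = 1" for z
  proof -
    have "z - of_real r * z = of_real (1 - r) * z" by (simp add: algebra_simps)
    then have "dist z (of_real r * z) < \<delta>"
      using r z by (simp add: dist_norm norm_mult del: of_real_diff)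
    then show ?thesis
      using \<delta>(2)[of "of_real r * z" z] r z by (simp add: dist_norm norm_mult)
  qed
  then have rb: "radial_bound c r (1/8)"
    using R unfolding radial_bound_def by blast
  have "(\<lambda>n. r ^ n) \<longlonglongrightarrow> 0" using r by (intro LIMSEQ_power_zero) auto
  then have "\<forall>\<^sub>F n in sequentially. r ^ n < 1/9"
    by (rule order_tendstoD) simp
  then obtain k where k: "r ^ k < 1/9" by (auto simp: eventually_sequentially)
  define N where "N = (2::nat) ^ k"
  have "k \<le> N" using less_exp[of k] by (simp add: N_def)
  then have rN: "r ^ N < 1/9"
    using k r power_decreasing[of k N r] by simp
  define s where "s = r ^ N"
  have s: "0 \<le> s" "s < 1/9" using rN r by (auto simp: s_def)
  obtain Q where Q: "\<And>z. cmod z \<le> 1 \<Longrightarrow>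
        (1 - z *\<^sub>C c ^ N) * Q z = 1 \<and> Q z * (1 - z *\<^sub>C c ^ N) = 1"
    and Qb: "\<And>z. cmod z = 1 \<Longrightarrow> norm (Q z - Q (of_real s * z)) \<le> 1/8"
    using radial_bound_power[OF rb, of k] r unfolding radial_bound_def N_def s_def
    by (metis less_imp_le)
  have cN: "norm (c ^ N) \<le> 1"
    using norm_power_ineq[of c N] nc power_le_one[of "norm c" N] by (meson norm_ge_zero order_trans)
  define y where "y = Q (of_real s)"
  have "(1 - of_real s *\<^sub>C c ^ N) * y = 1"
    using Q[of "of_real s"] s by (simp add: y_def)
  then have y1: "y - 1 = s *\<^sub>R (c ^ N * y)"
    by (simp add: scaleC_of_real algebra_simps)
  have "norm (c ^ N * y) \<le> 1 * norm y"
    using norm_mult_ineq[of "c ^ N" y] cN by (meson mult_right_mono norm_ge_zero order_trans)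
  then have "norm (y - 1) \<le> 1/9 * norm y"
    using s mult_mono[of s "1/9" "norm (c ^ N * y)" "norm y"] unfolding y1 by simp
  moreover have "norm y \<le> norm (y - 1) + 1"
    using norm_triangle_ineq[of "y - 1" 1] by simp
  ultimately have "norm (y - 1) \<le> 1/8" by linarith
  moreover have "norm (Q 1 - y) \<le> 1/8" using Qb[of 1] by (simp add: y_def)
  ultimately have h: "norm (Q 1 - 1) \<le> 1/4"
    using norm_triangle_ineq[of "Q 1 - y" "y - 1"] by simp
  \<comment> \<open>\<open>Q 1\<close> is the inverse of \<open>1 - c\<^sup>N\<close>, so its distance from \<open>1\<close> controls \<open>c\<^sup>N\<close>.\<close>
  have "c ^ N = (1 - c ^ N) * (Q 1 - 1)"
    using Q[of 1] by (simp add: algebra_simps)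
  then have "norm (c ^ N) \<le> norm (1 - c ^ N) * norm (Q 1 - 1)"
    by (metis norm_mult_ineq)
  also have "\<dots> \<le> 2 * (1/4)"
    using h cN norm_triangle_ineq4[of 1 "c ^ N"] by (intro mult_mono) auto
  finally show ?thesis unfolding N_def by (intro exI[of _ k]) simp
qed

lemma norm_power_self_adjoint:
  fixes a :: "'a::unital_cstar_algebra"
  assumes "self_adjoint a"
  shows "norm (a ^ (2 ^ k)) = norm a ^ (2 ^ k)"
proof -
  have "self_adjoint (a ^ (2 ^ k)) \<and> norm (a ^ (2 ^ k)) = norm a ^ (2 ^ k)"
  proof (induction k)
    case 0
    then show ?case using assms by simp
  next
    case (Suc k)
    have "a ^ (2 ^ Suc k) = a ^ (2 ^ k) * a ^ (2 ^ k)"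
      by (simp add: power_add[symmetric] mult_2)
    then show ?case
      using Suc self_adjoint_square[of "a ^ (2 ^ k)"] norm_square_self_adjoint[of "a ^ (2 ^ k)"]
      by (simp add: power_mult[symmetric] mult.commute)
  qed
  then show ?thesis ..
qed

text \<open>Normalise to norm \<open>1\<close>. Since the spectrum is real and lies in the disc of radius \<open>\<parallel>a\<parallel>\<close>,
  the points \<open>\<plusminus>\<parallel>a\<parallel>\<close> are the only obstacles to the resolvent existing on the whole closed unit
  disc. Were both absent, some power \<open>a\<^sup>N\<close>, \<open>N = 2\<^sup>k\<close>, would have norm below \<open>1\<close>, against
  \<open>\<parallel>a\<^sup>N\<parallel> = \<parallel>a\<parallel>\<^sup>N\<close>.\<close>

lemma norm_attained_on_spectrum:
  fixes a :: "'a::unital_cstar_algebra"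
  assumes sa: "self_adjoint a" and nz: "a \<noteq> 0"
  shows "of_real (norm a) \<in> cstar_spectrum a \<or> - of_real (norm a) \<in> cstar_spectrum a"
proof (rule ccontr)
  assume no: "\<not> ?thesis"
  define s where "s = norm a"
  have s: "s > 0" using nz by (simp add: s_def)
  define c where "c = (1/s) *\<^sub>R a"
  have nc: "norm c = 1" using s by (simp add: c_def s_def)
  have "invertible_elem (1 - z *\<^sub>C c)" if z: "cmod z \<le> 1" for z
  proof (cases "z = 0")
    case True
    then show ?thesis using invertible_one_minus[of 0] by simp
  next
    case False
    define w where "w = of_real s / z"
    have "w \<notin> cstar_spectrum a"
    proof
      assume w: "w \<in> cstar_spectrum a"
      then have "cmod w \<le> s" and im: "Im w = 0"
        using spectrum_norm_le self_adjoint_spectrum_real[OF sa] by (auto simp: s_def)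
      moreover have "s \<le> cmod w"
        using z False s by (simp add: w_def norm_divide pos_le_divide_eq mult_left_le)
      ultimately have "\<bar>Re w\<bar> = s" by (simp add: cmod_eq_Re)
      with im have "w = of_real s \<or> w = - of_real s"
        by (auto simp: complex_eq_iff)
      with w no show False by (auto simp: s_def)
    qed
    then have "invertible_elem ((z / of_real s) *\<^sub>C (w *\<^sub>C 1 - a))"
      using False s by (intro invertible_elem_scaleC) (auto simp: mem_spectrum_iff)
    moreover have "(z / of_real s) *\<^sub>C a = z *\<^sub>C c"
      unfolding c_def scaleC_of_real[symmetric] by (simp add: scaleC_scaleC)
    ultimately show ?thesis
      using False s by (simp add: scaleC_diff_right scaleC_scaleC w_def)
  qed
  then obtain k where "norm (c ^ (2 ^ k)) < 1"
    using power_norm_less_one[of c] nc by auto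
  moreover have "norm (c ^ (2 ^ k)) = 1"
    using norm_power_self_adjoint[of c k] self_adjoint_scaleR[OF sa, of "1/s"] nc
    by (simp flip: c_def)
  ultimately show False by simp
qed

section \<open>The positive cone\<close>

lemma positive_self_adjoint: "cstar_positive a \<Longrightarrow> self_adjoint a"
  by (simp add: cstar_positive_def)

lemma positive_not_negative_spectrum:
  assumes "cstar_positive a" "of_real t \<in> cstar_spectrum a"
  shows "0 \<le> t"
  using assms by (auto simp: cstar_positive_def)

text \<open>The spectrum of a positive \<open>a\<close> lies in \<open>[0, t]\<close> when \<open>t \<ge> \<parallel>a\<parallel>\<close>, hence so does that of \<open>t - a\<close>,
  which attains its norm there. Together with its converse this describes positivity by a norm
  inequality, from which closure under addition is the triangle inequality.\<close>

lemma positive_imp_norm_le: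
  fixes a :: "'a::unital_cstar_algebra"
  assumes a: "cstar_positive a" and t: "norm a \<le> t"
  shows "norm (t *\<^sub>R 1 - a) \<le> t"
proof (rule ccontr)
  define b where "b = t *\<^sub>R 1 - a"
  define s where "s = norm b"
  assume "\<not> norm (t *\<^sub>R 1 - a) \<le> t"
  then have s: "s > t" by (simp add: s_def b_def)
  have t0: "0 \<le> t" using t norm_ge_zero order_trans by blast
  have b: "b = of_real t *\<^sub>C 1 - a" by (simp add: b_def scaleC_of_real)
  have "self_adjoint b"
    unfolding b_def
    by (intro self_adjoint_diff self_adjoint_scaleR self_adjoint_one positive_self_adjoint a)
  moreover have "b \<noteq> 0" using s t0 by (auto simp: s_def)
  ultimately have "of_real s \<in> cstar_spectrum b \<or> - of_real s \<in> cstar_spectrum b"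
    unfolding s_def by (rule norm_attained_on_spectrum)
  then have "of_real (t - s) \<in> cstar_spectrum a \<or> of_real (t + s) \<in> cstar_spectrum a"
    using spectrum_reflect[of "of_real t" "of_real (t - s)" a]
      spectrum_reflect[of "of_real t" "of_real (t + s)" a] by (simp add: b)
  then show False
  proof
    assume "of_real (t - s) \<in> cstar_spectrum a"
    then show False using positive_not_negative_spectrum[OF a] s by fastforce
  next
    assume "of_real (t + s) \<in> cstar_spectrum a"
    from spectrum_norm_le[OF this] show False
      using t s t0 by (simp del: of_real_add)
  qed
qed

lemma norm_le_imp_positive:
  fixes a :: "'a::unital_cstar_algebra"
  assumes sa: "self_adjoint a" and t: "norm (t *\<^sub>R 1 - a) \<le> t"
  shows "cstar_positive a"
  unfolding cstar_positive_def
proof (intro conjI sa subsetI)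
  fix c assume c: "c \<in> cstar_spectrum a"
  then have c_real: "c = of_real (Re c)"
    using self_adjoint_spectrum_real[OF sa] by (simp add: complex_eq_iff)
  have "of_real t - c \<in> cstar_spectrum (t *\<^sub>R 1 - a)"
    using c spectrum_reflect[of "of_real t" c a] by (simp add: scaleC_of_real)
  then have "cmod (of_real t - c) \<le> t"
    using spectrum_norm_le t order_trans by blast
  then have "0 \<le> Re c"
    using abs_Re_le_cmod[of "of_real t - c"] by simp
  then show "c \<in> of_real ` {0..}" using c_real by (metis atLeast_iff imageI)
qed

lemma positive_add:
  fixes a b :: "'a::unital_cstar_algebra"
  assumes "cstar_positive a" "cstar_positive b"
  shows "cstar_positive (a + b)"
proof (rule norm_le_imp_positive)
  show "self_adjoint (a + b)"
    using assms by (simp add: self_adjoint_add positive_self_adjoint)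
  have "(norm a + norm b) *\<^sub>R 1 - (a + b) = (norm a *\<^sub>R 1 - a) + (norm b *\<^sub>R 1 - b)"
    by (simp add: algebra_simps)
  then show "norm ((norm a + norm b) *\<^sub>R 1 - (a + b)) \<le> norm a + norm b"
    using positive_imp_norm_le[OF assms(1) order_refl] positive_imp_norm_le[OF assms(2) order_refl]
      norm_triangle_le add_mono by metis
qed

lemma positive_norm_minus:
  fixes a :: "'a::unital_cstar_algebra"
  assumes "self_adjoint a" "norm a \<le> t"
  shows "cstar_positive (t *\<^sub>R 1 - a)"
  by (rule norm_le_imp_positive[where t = t])
    (use assms in \<open>auto intro: self_adjoint_diff self_adjoint_scaleR self_adjoint_one\<close>)

text \<open>If \<open>0 \<preceq> a \<preceq> b\<close> then \<open>a \<preceq> \<parallel>b\<parallel>\<close>, so no spectral value of \<open>a\<close> exceeds \<open>\<parallel>b\<parallel>\<close>; but \<open>\<parallel>a\<parallel>\<close>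
  is one unless \<open>a = 0\<close>.\<close>

lemma norm_mono_positive:
  fixes a b :: "'a::unital_cstar_algebra"
  assumes a: "0 \<preceq> a" and ab: "a \<preceq> b"
  shows "norm a \<le> norm b"
proof (rule ccontr)
  assume "\<not> norm a \<le> norm b"
  then have lt: "norm b < norm a" by simp
  have pa: "cstar_positive a" and pba: "cstar_positive (b - a)" and sb: "self_adjoint b"
    using a ab by (auto simp: cstar_le_def)
  have "cstar_positive ((norm b *\<^sub>R 1 - b) + (b - a))"
    using positive_add positive_norm_minus pba sb by blast
  then have pos: "cstar_positive (of_real (norm b) *\<^sub>C 1 - a)"
    by (simp add: scaleC_of_real)
  have "a \<noteq> 0" using lt by auto
  then consider "of_real (norm a) \<in> cstar_spectrum a" | "of_real (- norm a) \<in> cstar_spectrum a"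
    using norm_attained_on_spectrum positive_self_adjoint[OF pa] by fastforce
  then show False
  proof cases
    case 1
    then have "of_real (norm b - norm a) \<in> cstar_spectrum (of_real (norm b) *\<^sub>C 1 - a)"
      by (simp add: spectrum_reflect)
    then show False using positive_not_negative_spectrum[OF pos] lt by fastforce
  next
    case 2
    then show False using positive_not_negative_spectrum[OF pa] \<open>a \<noteq> 0\<close> by fastforce
  qed
qed

lemma self_adjoint_small_square_le:
  fixes q :: "'a::unital_cstar_algebra"
  assumes "self_adjoint q" "norm q \<le> \<epsilon>"
  shows "q * adj q \<preceq> \<epsilon>\<^sup>2 *\<^sub>R 1"
proof -
  have "norm (q * q) \<le> \<epsilon>\<^sup>2"
    using assms by (simp add: norm_square_self_adjoint power_mono)
  then show ?thesis
    using assms positive_norm_minus[of "q * q" "\<epsilon>\<^sup>2"]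
    by (simp add: cstar_le_def self_adjoint_square self_adjoint_scaleR self_adjoint_one)
      (simp add: self_adjoint_def adj_mult adj_scaleR)
qed

section \<open>Scalar estimates in a partial metric space\<close>

context cstar_partial_metric_space
begin

lemma self_adjoint_p: "x \<in> X \<Longrightarrow> y \<in> X \<Longrightarrow> self_adjoint (p x y)"
  using nonneg by (auto simp: cstar_le_def)

lemma norm_self_le: "x \<in> X \<Longrightarrow> y \<in> X \<Longrightarrow> norm (p x x) \<le> norm (p x y)"
  using norm_mono_positive nonneg self_le by blast

text \<open>The subtracted \<open>p z z\<close> is positive and may be dropped.\<close>

lemma norm_triangle_p:
  assumes "x \<in> X" "y \<in> X" "z \<in> X"
  shows "norm (p x y) \<le> norm (p x z) + norm (p z y)"
proof -
  have "cstar_positive (p x z + p z y - p z z - p x y)" "cstar_positive (p z z)"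
    using triangle[OF assms] nonneg[of z z] assms by (auto simp: cstar_le_def)
  from positive_add[OF this] have "cstar_positive (p x z + p z y - p x y)" by simp
  then have "p x y \<preceq> p x z + p z y"
    using assms by (simp add: cstar_le_def self_adjoint_p self_adjoint_add)
  then have "norm (p x y) \<le> norm (p x z + p z y)"
    using norm_mono_positive nonneg assms by blast
  then show ?thesis using norm_triangle_ineq order_trans by blast
qed

text \<open>Both self-distances are dominated by \<open>p x y\<close>, so all three values agree.\<close>

lemma eq_if_p_zero:
  assumes "x \<in> X" "y \<in> X" "p x y = 0"
  shows "x = y"
  using norm_self_le[of x y] norm_self_le[of y x] commute[of x y] eq_iff[of x y] assms by simp

lemma partial_Cauchy_if_norm:
  assumes s: "\<And>n. s n \<in> X"
    and small: "\<And>\<epsilon>. \<epsilon> > 0 \<Longrightarrow> \<exists>N. \<forall>n>N. \<forall>m>N. norm (p (s n) (s m)) < \<epsilon>"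
  shows "partial_Cauchy s"
  unfolding partial_Cauchy_def
proof (intro allI impI)
  fix \<epsilon> :: real assume "\<epsilon> > 0"
  then obtain N where N: "\<And>n m. n > N \<Longrightarrow> m > N \<Longrightarrow> norm (p (s n) (s m)) < \<epsilon>/2"
    using small[of "\<epsilon>/2"] by auto
  have "centred (s n) (s m) * adj (centred (s n) (s m)) \<preceq> \<epsilon>\<^sup>2 *\<^sub>R 1" if "n > N" "m > N" for n m
  proof (rule self_adjoint_small_square_le)
    show "self_adjoint (centred (s n) (s m))"
      unfolding centred_def by (intro self_adjoint_diff self_adjoint_scaleR self_adjoint_p s)
    have "norm (centred (s n) (s m))
        \<le> norm (p (s n) (s m)) + norm (p (s n) (s n)) / 2 + norm (p (s m) (s m)) / 2"
      unfolding centred_def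
      using norm_triangle_ineq4[of "p (s n) (s m)" "(1/2) *\<^sub>R p (s n) (s n)"]
        norm_triangle_ineq4[of "p (s n) (s m) - (1/2) *\<^sub>R p (s n) (s n)" "(1/2) *\<^sub>R p (s m) (s m)"]
      by simp
    then show "norm (centred (s n) (s m)) \<le> \<epsilon>"
      using N[of n m] N[of n n] N[of m m] that by linarith
  qed
  then show "\<exists>N. \<forall>n>N. \<forall>m>N.
      centred (s n) (s m) * adj (centred (s n) (s m)) \<preceq> \<epsilon>\<^sup>2 *\<^sub>R 1" by blast
qed

text \<open>The geometric-series estimate. The case \<open>m = n\<close> does not come for free, as
  self-distances need not vanish; they are dominated by \<open>p (s n) (s (Suc n))\<close>.\<close>

lemma partial_Cauchy_geometric:
  assumes s: "\<And>n. s n \<in> X" and \<delta>: "0 \<le> \<delta>" "\<delta> < 1"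
    and step: "\<And>n. norm (p (s (Suc n)) (s (Suc (Suc n)))) \<le> \<delta> * norm (p (s n) (s (Suc n)))"
  shows "partial_Cauchy s"
    and "(\<lambda>n. norm (p (s n) (s (Suc n)))) \<longlonglongrightarrow> 0"
proof -
  define B where "B = norm (p (s 0) (s 1))"
  have geo: "norm (p (s n) (s (Suc n))) \<le> \<delta> ^ n * B" for n
  proof (induction n)
    case (Suc n)
    then have "\<delta> * norm (p (s n) (s (Suc n))) \<le> \<delta> * (\<delta> ^ n * B)"
      using \<delta> by (intro mult_left_mono) auto
    then show ?case using step[of n] by simp
  qed (simp add: B_def)
  have tail: "norm (p (s n) (s (n + k))) \<le> \<delta> ^ n * (B / (1 - \<delta>))" for n k
  proof (induction k arbitrary: n)
    case 0
    have "B \<le> B / (1 - \<delta>)" using \<delta> by (simp add: B_def pos_le_divide_eq mult_left_le)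
    then have "\<delta> ^ n * B \<le> \<delta> ^ n * (B / (1 - \<delta>))" using \<delta> by (intro mult_left_mono) auto
    then show ?case using norm_self_le[of "s n" "s (Suc n)"] s geo[of n] by simp
  next
    case (Suc k)
    have "norm (p (s n) (s (n + Suc k)))
        \<le> norm (p (s n) (s (Suc n))) + norm (p (s (Suc n)) (s (Suc n + k)))"
      using norm_triangle_p[of "s n" "s (n + Suc k)" "s (Suc n)"] s by simp
    also have "\<dots> \<le> \<delta> ^ n * B + \<delta> ^ Suc n * (B / (1 - \<delta>))"
      using geo[of n] Suc[of "Suc n"] by linarith
    also have "\<dots> = \<delta> ^ n * (B / (1 - \<delta>))"
      using \<delta> by (simp add: field_simps)
    finally show ?case .
  qed
  have pow: "(\<lambda>n. \<delta> ^ n * C) \<longlonglongrightarrow> 0" for C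
    using \<delta> by (intro tendsto_mult_left_zero LIMSEQ_power_zero) auto
  show "(\<lambda>n. norm (p (s n) (s (Suc n)))) \<longlonglongrightarrow> 0"
    by (rule tendsto_sandwich[OF _ _ tendsto_const pow[of B]]) (use geo in auto)
  show "partial_Cauchy s"
  proof (rule partial_Cauchy_if_norm[OF s])
    fix \<epsilon> :: real assume "\<epsilon> > 0"
    then have "\<forall>\<^sub>F n in sequentially. \<delta> ^ n * (B / (1 - \<delta>)) < \<epsilon>"
      by (intro order_tendstoD(2)[OF pow])
    then obtain N where N: "\<And>n. n \<ge> N \<Longrightarrow> \<delta> ^ n * (B / (1 - \<delta>)) < \<epsilon>"
      by (auto simp: eventually_sequentially)
    have ord: "norm (p (s n) (s m)) < \<epsilon>" if "n > N" "n \<le> m" for n m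
      using tail[of n "m - n"] N[of n] that by simp
    have "norm (p (s n) (s m)) < \<epsilon>" if "n > N" "m > N" for n m
      using ord[of n m] ord[of m n] that commute[of "s n" "s m"] s by (cases "n \<le> m") auto
    then show "\<exists>N. \<forall>n>N. \<forall>m>N. norm (p (s n) (s m)) < \<epsilon>" by blast
  qed
qed

text \<open>If the self-distances of the sequence vanish, the two limits that completeness provides
  put \<open>p (s n) u\<close> near both \<open>p u u\<close> and half of it.\<close>

lemma limit_self_distance_zero:
  assumes conv: "converges_to s u" "(\<lambda>n. centred (s n) u) \<longlonglongrightarrow> 0"
    and self: "(\<lambda>n. p (s n) (s n)) \<longlonglongrightarrow> 0"
  shows "p u u = 0"
proof -
  have "(\<lambda>n. (p (s n) u - p u u) - centred (s n) u - (1/2) *\<^sub>R p (s n) (s n))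
      \<longlonglongrightarrow> 0 - 0 - (1/2) *\<^sub>R 0"
    using conv self unfolding converges_to_def by (intro tendsto_intros)
  moreover have "(p (s n) u - p u u) - centred (s n) u - (1/2) *\<^sub>R p (s n) (s n)
      = - ((1/2) *\<^sub>R p u u)" for n
  proof -
    have "p u u = (1/2) *\<^sub>R p u u + (1/2) *\<^sub>R p u u" by (simp flip: scaleR_add_left)
    then show ?thesis unfolding centred_def by (simp add: algebra_simps)
  qed
  ultimately show ?thesis by (simp add: LIMSEQ_const_iff)
qed

end

section \<open>The fixed point theorem\<close>

theorem corollary4p5:
  fixes X :: "'x set"
    and p :: "'x \<Rightarrow> 'x \<Rightarrow> 'a::unital_cstar_algebra"
    and T :: "'x \<Rightarrow> 'x"
    and \<alpha> \<beta> \<gamma> :: real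
  assumes "complete_cstar_partial_metric_space X p"
    and "\<And>x. x \<in> X \<Longrightarrow> T x \<in> X"
    and "0 \<le> \<alpha>" and "0 \<le> \<beta>" and "0 \<le> \<gamma>" and "\<alpha> + \<beta> + \<gamma> < 1"
    and "\<And>x y. \<lbrakk>x \<in> X; y \<in> X\<rbrakk> \<Longrightarrow>
      p (T x) (T y) \<preceq> \<alpha> *\<^sub>R p x y + \<beta> *\<^sub>R p x (T x) + \<gamma> *\<^sub>R p y (T y)"
  shows "\<exists>u\<in>X. T u = u \<and> p u u = 0 \<and> (\<forall>v\<in>X. T v = v \<longrightarrow> v = u)"
proof -
  interpret complete_cstar_partial_metric_space X p by fact
  note TX = assms(2)
  have contr: "norm (p (T x) (T y))
      \<le> \<alpha> * norm (p x y) + \<beta> * norm (p x (T x)) + \<gamma> * norm (p y (T y))"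
    if "x \<in> X" "y \<in> X" for x y
  proof -
    have "norm (p (T x) (T y)) \<le> norm (\<alpha> *\<^sub>R p x y + \<beta> *\<^sub>R p x (T x) + \<gamma> *\<^sub>R p y (T y))"
      using norm_mono_positive nonneg TX assms(7) that by blast
    also have "\<dots> \<le> norm (\<alpha> *\<^sub>R p x y) + norm (\<beta> *\<^sub>R p x (T x)) + norm (\<gamma> *\<^sub>R p y (T y))"
      by (intro norm_triangle_le add_mono order_refl)
    finally show ?thesis using assms(3-5) by simp
  qed
  have self_zero: "p v v = 0" if "v \<in> X" "T v = v" for v
  proof -
    have "norm (p v v) \<le> (\<alpha> + \<beta> + \<gamma>) * norm (p v v)"
      using contr[OF that(1) that(1)] that(2) by (simp add: algebra_simps)
    then have "(1 - (\<alpha> + \<beta> + \<gamma>)) * norm (p v v) \<le> 0" by (simp add: algebra_simps)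
    then show ?thesis using assms(6) by (simp add: mult_le_0_iff)
  qed
  obtain x0 where x0: "x0 \<in> X" using nonempty by blast
  define s where "s n = (T ^^ n) x0" for n
  have s: "s n \<in> X" for n by (induction n) (auto simp: s_def x0 TX)
  have sT: "T (s n) = s (Suc n)" for n by (simp add: s_def)
  \<comment> \<open>The distance from \<open>x\<^sub>n\<^sub>+\<^sub>1\<close> to \<open>x\<^sub>n\<^sub>+\<^sub>2\<close> also occurs on the right, with factor \<open>\<gamma>\<close>;
    solving for it divides by \<open>1 - \<gamma>\<close>.\<close>
  define \<delta> where "\<delta> = (\<alpha> + \<beta>) / (1 - \<gamma>)"
  have \<delta>: "0 \<le> \<delta>" "\<delta> < 1" using assms(3-6) by (auto simp: \<delta>_def)
  have step: "norm (p (s (Suc n)) (s (Suc (Suc n)))) \<le> \<delta> * norm (p (s n) (s (Suc n)))" for n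
  proof -
    have "(1 - \<gamma>) * norm (p (s (Suc n)) (s (Suc (Suc n)))) \<le> (\<alpha> + \<beta>) * norm (p (s n) (s (Suc n)))"
      using contr[OF s[of n] s[of "Suc n"]] by (simp add: sT algebra_simps)
    then show ?thesis using assms(3-6) by (simp add: \<delta>_def field_simps)
  qed
  note step_lim = partial_Cauchy_geometric(2)[of s, OF s \<delta> step]
  obtain u where u: "u \<in> X" "converges_to s u" "(\<lambda>n. centred (s n) u) \<longlonglongrightarrow> 0"
    using complete[OF s partial_Cauchy_geometric(1)[of s, OF s \<delta> step]] by blast
  have "(\<lambda>n. p (s n) (s n)) \<longlonglongrightarrow> 0"
    by (rule Lim_null_comparison[OF _ step_lim]) (simp add: norm_self_le s)
  then have puu: "p u u = 0" using limit_self_distance_zero u by blast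
  then have "(\<lambda>n. p (s n) u) \<longlonglongrightarrow> 0"
    using u(2) by (simp add: converges_to_def)
  then have su: "(\<lambda>n. norm (p (s n) u)) \<longlonglongrightarrow> 0"
    by (rule tendsto_norm_zero)
  have "norm (p u (T u)) \<le> norm (p (s (Suc n)) u)
      + (\<alpha> * norm (p (s n) u) + \<beta> * norm (p (s n) (s (Suc n))) + \<gamma> * norm (p u (T u)))" for n
    using norm_triangle_p[of u "T u" "s (Suc n)"] contr[OF s[of n] u(1)]
      commute[of u "s (Suc n)"] s[of "Suc n"] u(1) TX by (simp add: sT)
  moreover have "(\<lambda>n. norm (p (s (Suc n)) u)
      + (\<alpha> * norm (p (s n) u) + \<beta> * norm (p (s n) (s (Suc n))) + \<gamma> * norm (p u (T u))))
      \<longlonglongrightarrow> 0 + (\<alpha> * 0 + \<beta> * 0 + \<gamma> * norm (p u (T u)))"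
    by (intro tendsto_intros su step_lim LIMSEQ_Suc[OF su])
  ultimately have "norm (p u (T u)) \<le> 0 + (\<alpha> * 0 + \<beta> * 0 + \<gamma> * norm (p u (T u)))"
    by (intro LIMSEQ_le_const) auto
  then have "(1 - \<gamma>) * norm (p u (T u)) \<le> 0" by (simp add: algebra_simps)
  then have "p u (T u) = 0" using assms(3-6) by (simp add: mult_le_0_iff)
  then have Tu: "T u = u" using eq_if_p_zero u(1) TX by metis
  have "v = u" if v: "v \<in> X" "T v = v" for v
  proof -
    have "norm (p v u) \<le> \<alpha> * norm (p v u)"
      using contr[OF v(1) u(1)] v(2) Tu puu self_zero[OF v] by simp
    then have "(1 - \<alpha>) * norm (p v u) \<le> 0" by (simp add: algebra_simps)
    then have "p v u = 0" using assms(3-6) by (simp add: mult_le_0_iff)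
    then show ?thesis using eq_if_p_zero v u(1) by blast
  qed
  then show ?thesis using u(1) Tu puu by blast
qed

end
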